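(* Let $f:\mathbb{R}^n\to\mathbb{R}$ be a $C^2$ function satisfying the standing assumptions on $f$ (see context) on the compact neighbourhood $\mathcal N$. Let $\Psi:\mathbb{R}^{n_1}\to\mathbb{R}^{n_2}$ be an affine mapping, and let $\Phi(x_1)=(x_1,\Psi(x_1))$, $F=f\circ\Phi$, $\mathcal M_F=\Phi(\mathbb{R}^{n_1})$ and $\mathcal M_F^{\mathrm{loc}}=\mathcal M_F\cap\mathcal N$. Let $\sigma_1,\dots,\sigma_n$ be the singular values of $\nabla^2 f(x)$ in descending order. Suppose that for every $x\in\mathcal M_F^{\mathrm{loc}}$ the largest singular value $\sigma_{\max}(\nabla^2 f(x))$ has multiplicity $p\ge 1$, with associated dominant subspace $\Sigma_{\max}=\Sigma_{\max}(x)$. Assume: 1. There is a uniform constant $\varepsilon\in(0,1]$ such that, for every $x\in\mathcal M_F^{\mathrm{loc}}$ and all unit vectors $v\in\Sigma_{\max}(x)$, $$\|\mathrm P_{\mathrm T_x\mathcal M_F^{\mathrm{loc}}}v\|\le 1-\varepsilon,$$ where $\mathrm P_{\mathrm T_x\mathcal M_F^{\mathrm{loc}}}$ is the orthogonal projection onto the tangent space $\mathrm T_x\mathcal M_F^{\mathrm{loc}}$. 2. There is a uniform spectral gap $$\Delta_{\max}:=\inf_{x\in\mathcal M_F^{\mathrm{loc}}}\big[\sigma_{\max}(\nabla^2 f(x))-\sigma_{p+1}(\nabla^2 f(x))\big]>0.$$ Then, equipping $\mathbb{R}^{n_1}$ with the pullback metric induced by the embedding $\Phi$, the Riemannian gradient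 of $F$ is Lipschitz continuous with constant $\beta_F$ satisfying $$\beta_F\le\beta_f-\Delta_{\max}(2\varepsilon-\varepsilon^2)<\beta_f.$$
   Context: Write $n=n_1+n_2$ with $n_1,n_2\ge 1$, and $x=(x_1,x_2)\in\mathbb{R}^{n_1}\times\mathbb{R}^{n_2}$. The set of minimisers is $\mathcal S=\{x\in\mathbb{R}^n: x\text{ is a local minimum of } f,\ f(x)=0\}$. Standing assumptions on $f$: there are constants $L,\beta_f,\mu_f>0$ and a compact neighbourhood $\mathcal N\subset\mathbb{R}^n$ of a minimiser $\bar x$ such that (i) $f$ attains its infimum, which equals $0$, and $\mathcal S\neq\emptyset$; (ii) on $\mathcal N$, $f$ is $L$-Lipschitz and $\beta_f$-smooth (its gradient is $\beta_f$-Lipschitz); (iii) $f(x)\le\frac{1}{2\mu_f}\|\nabla f(x)\|^2$ for every $x\in\mathcal N$. Standing assumptions on $F$: $F$ is $\beta_F$-smooth in the neighbourhood, and $\mathcal S_F:=\mathcal M_F\cap\mathcal S$ is non-empty and forms the set of minimisers of $F$. Dominant subspace: $\Sigma_{\max}(x)=\mathrm{span}\{v:\nabla^2 f(x)v=\lambda v,\ |\lambda|=\sigma_{\max}(\nabla^2f(x))\}$. Pullback metric: $\langle u,v\rangle_R=u^\top R v$ with $R=\mathrm D\Phi(x_1)^\top\mathrm D\Phi(x_1)$. Smoothness constants: $\beta_f=\sup_{x\in\mathcal N}\|\nabla^2 f(x)\|$ (operator norm) and $\beta_F=\sup_{x_1:\Phi(x_1)\in\mathcal N}\|\nabla^2F(x_1)\|_R$,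 where $\|H\|_R=\max_{y\ne0}|y^\top Hy|/(y^\top Ry)$ for symmetric $H$. *)

theory Defs
  imports "HOL-Analysis.Analysis"
begin

section \<open>Derivatives\<close>

definition grad :: "('a::euclidean_space \<Rightarrow> real) \<Rightarrow> 'a \<Rightarrow> 'a" where
  "grad f x = (THE g. GDERIV f x :> g)"

definition hess :: "('a::euclidean_space \<Rightarrow> real) \<Rightarrow> 'a \<Rightarrow> 'a \<Rightarrow> 'a" where
  "hess f x = frechet_derivative (grad f) (at x)"

text \<open>Continuity of the Hessian is stated vector by vector; in finite dimension this is
  continuity in operator norm.\<close>

definition C2 :: "('a::euclidean_space \<Rightarrow> real) \<Rightarrow> bool" where
  "C2 f \<longleftrightarrow> (\<forall>x. f differentiable (at x)) \<and> (\<forall>x. grad f differentiable (at x)) \<and>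
     (\<forall>v. continuous_on UNIV (\<lambda>x. hess f x v))"

definition minimisers :: "('a::euclidean_space \<Rightarrow> real) \<Rightarrow> 'a set" where
  "minimisers f = {x. (\<forall>\<^sub>F y in nhds x. f x \<le> f y) \<and> f x = 0}"

definition affine_map :: "('a::real_vector \<Rightarrow> 'b::real_vector) \<Rightarrow> bool" where
  "affine_map \<Psi> \<longleftrightarrow> (\<exists>A b. linear A \<and> \<Psi> = (\<lambda>x. A x + b))"


section \<open>Singular values of a linear operator\<close>

definition singular_values :: "('a::euclidean_space \<Rightarrow> 'a) \<Rightarrow> real set" where
  "singular_values A = {s. 0 \<le> s \<and> (\<exists>v. v \<noteq> 0 \<and> adjoint A (A v) = s\<^sup>2 *\<^sub>R v)}"

definition sing_mult :: "('a::euclidean_space \<Rightarrow> 'a) \<Rightarrow> real \<Rightarrow> nat" where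
  "sing_mult A s = dim {v. adjoint A (A v) = s\<^sup>2 *\<^sub>R v}"

text \<open>The list of singular values in descending order, each repeated according to its
  multiplicity. The index set of the sum is finite, see \<open>finite_singular_values\<close> below.\<close>

definition sing_list :: "('a::euclidean_space \<Rightarrow> 'a) \<Rightarrow> real list" where
  "sing_list A = rev (sorted_list_of_multiset
     (\<Sum>s\<in>singular_values A. replicate_mset (sing_mult A s) s))"

text \<open>Counted from 1, for \<open>1 \<le> k \<le> DIM('a)\<close>.\<close>

definition sing_val :: "('a::euclidean_space \<Rightarrow> 'a) \<Rightarrow> nat \<Rightarrow> real" where
  "sing_val A k = sing_list A ! (k - 1)"

abbreviation sing_max :: "('a::euclidean_space \<Rightarrow> 'a) \<Rightarrow> real" where
  "sing_max A \<equiv> sing_val A 1"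

definition dominant_subspace :: "('a::euclidean_space \<Rightarrow> 'a) \<Rightarrow> 'a set" where
  "dominant_subspace A = span {v. \<exists>l. A v = l *\<^sub>R v \<and> \<bar>l\<bar> = sing_max A}"

lemma finite_singular_values:
  fixes A :: "'a::euclidean_space \<Rightarrow> 'a"
  assumes "linear A"
  shows "finite (singular_values A)"
proof -
  define v where "v s = (SOME v. v \<noteq> 0 \<and> adjoint A (A v) = s\<^sup>2 *\<^sub>R v)" for s
  have v: "v s \<noteq> 0 \<and> adjoint A (A (v s)) = s\<^sup>2 *\<^sub>R v s" if "s \<in> singular_values A" for s
    using that unfolding v_def singular_values_def mem_Collect_eq
    by (elim conjE) (rule someI_ex)
  have orth: "v s \<bullet> v t = 0"
    if "s \<in> singular_values A" "t \<in> singular_values A" "s \<noteq> t" for s t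
  proof -
    have "(adjoint A (A (v s))) \<bullet> v t = v s \<bullet> adjoint A (A (v t))"
      using assms by (simp add: adjoint_clauses adjoint_works)
    then have "s\<^sup>2 * (v s \<bullet> v t) = t\<^sup>2 * (v s \<bullet> v t)"
      using v that by simp
    moreover have "s\<^sup>2 \<noteq> t\<^sup>2"
      using that unfolding singular_values_def by (auto simp: power2_eq_iff)
    ultimately show ?thesis by simp
  qed
  have inj: "inj_on v (singular_values A)"
    using orth v by (metis inj_onI inner_eq_zero_iff)
  have "pairwise orthogonal (v ` singular_values A)"
    unfolding pairwise_def orthogonal_def using orth by blast
  moreover have "0 \<notin> v ` singular_values A"
    using v by force
  ultimately have "independent (v ` singular_values A)"
    by (rule pairwise_orthogonal_independent)
  then have "finite (v ` singular_values A)"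
    by (rule independent_imp_finite)
  then show ?thesis using inj finite_imageD by blast
qed


section \<open>The embedded graph and its pullback metric\<close>

text \<open>Orthogonal projection onto a linear subspace \<open>T\<close>.\<close>

definition orth_proj :: "'a::euclidean_space set \<Rightarrow> 'a \<Rightarrow> 'a" where
  "orth_proj T v = (THE w. w \<in> T \<and> (\<forall>u\<in>T. orthogonal (v - w) u))"

definition graph_map :: "('a \<Rightarrow> 'b) \<Rightarrow> 'a \<Rightarrow> 'a \<times> 'b" where
  "graph_map \<Psi> x = (x, \<Psi> x)"

text \<open>Tangent space at a point \<open>x\<close> of the graph, whose parameter is \<open>fst x\<close>.\<close>

definition tangent_space ::
    "('a::euclidean_space \<Rightarrow> 'b::euclidean_space) \<Rightarrow> 'a \<times> 'b \<Rightarrow> ('a \<times> 'b) set" where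
  "tangent_space \<Psi> x = range (frechet_derivative (graph_map \<Psi>) (at (fst x)))"

definition pullback_op ::
    "('a::euclidean_space \<Rightarrow> 'b::euclidean_space) \<Rightarrow> 'a \<Rightarrow> 'a \<Rightarrow> 'a" where
  "pullback_op \<Phi> x =
     adjoint (frechet_derivative \<Phi> (at x)) \<circ> frechet_derivative \<Phi> (at x)"

definition inner_wrt :: "('a::euclidean_space \<Rightarrow> 'a) \<Rightarrow> 'a \<Rightarrow> 'a \<Rightarrow> real" where
  "inner_wrt R u v = u \<bullet> R v"

definition norm_wrt :: "('a::euclidean_space \<Rightarrow> 'a) \<Rightarrow> 'a \<Rightarrow> real" where
  "norm_wrt R u = sqrt (inner_wrt R u u)"

text \<open>The norm of a symmetric operator \<open>H\<close> relative to \<open>R\<close>; the supremum is attained when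
  \<open>R\<close> is positive definite.\<close>

definition form_norm_wrt :: "('a::euclidean_space \<Rightarrow> 'a) \<Rightarrow> ('a \<Rightarrow> 'a) \<Rightarrow> real" where
  "form_norm_wrt R H = (SUP y\<in>-{0}. \<bar>y \<bullet> H y\<bar> / (y \<bullet> R y))"

definition riem_grad ::
    "('a::euclidean_space \<Rightarrow> 'a \<Rightarrow> 'a) \<Rightarrow> ('a \<Rightarrow> real) \<Rightarrow> 'a \<Rightarrow> 'a" where
  "riem_grad R F x = (THE g. \<forall>v. inner_wrt (R x) g v = frechet_derivative F (at x) v)"

text \<open>Lipschitz continuity of a vector field \<open>G\<close> on \<open>D\<close> in the Riemannian sense: along every
  geodesic contained in \<open>D\<close>, the transported difference of the values of \<open>G\<close> at the end points
  is at most \<open>L\<close> times the length of the geodesic. The definition is meant for a metric \<open>R\<close>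
  that does not depend on the base point, such as the pullback metric of an affine map: then
  geodesics are straight segments, parallel transport is the identity, and it is immaterial at
  which point of the segment \<open>R\<close> is taken. On a convex \<open>D\<close> this is the usual Lipschitz condition,
  see \<open>riem_lipschitz_on_convex\<close>.\<close>

definition riem_lipschitz_on ::
    "real \<Rightarrow> ('a::euclidean_space \<Rightarrow> 'a \<Rightarrow> 'a) \<Rightarrow> 'a set \<Rightarrow> ('a \<Rightarrow> 'a) \<Rightarrow> bool" where
  "riem_lipschitz_on L R D G \<longleftrightarrow> 0 \<le> L \<and>
     (\<forall>x y. closed_segment x y \<subseteq> D \<longrightarrow>
        norm_wrt (R x) (G y - G x) \<le> L * norm_wrt (R x) (y - x))"

lemma riem_lipschitz_on_convex:
  assumes "convex D"
  shows "riem_lipschitz_on L R D G \<longleftrightarrow> 0 \<le> L \<and>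
    (\<forall>x\<in>D. \<forall>y\<in>D. norm_wrt (R x) (G y - G x) \<le> L * norm_wrt (R x) (y - x))"
  using assms unfolding riem_lipschitz_on_def convex_contains_segment
  by (meson ends_in_segment subsetD)

end

theory Submission
  imports Defs
begin

text \<open>The Hessian of \<open>F = f \<circ> \<Phi>\<close> at \<open>x\<close> is the restriction of the quadratic form of
  \<open>H = \<nabla>\<^sup>2 f (\<Phi> x)\<close> to the tangent space of the graph, and the pullback metric is the restriction
  of the Euclidean one: with \<open>u = D y\<close>, where \<open>D\<close> is the constant derivative of \<open>\<Phi>\<close>,
  \<open>y \<bullet> \<nabla>\<^sup>2 F x y = u \<bullet> H u\<close> and \<open>y \<bullet> R y = \<bar>u\<bar>\<^sup>2\<close>. So everything follows from a bound of \<open>u \<bullet> H u\<close>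
  for unit tangent vectors \<open>u\<close>.

  Split \<open>u = v + w\<close> with \<open>v\<close> in the dominant subspace and \<open>w\<close> orthogonal to it. Both parts are
  invariant under \<open>H\<close>, so the mixed terms vanish. On the first part \<open>H\<close> has norm
  \<open>\<sigma>\<^sub>m\<^sub>a\<^sub>x\<close>, on the second at most \<open>\<sigma>\<^sub>m\<^sub>a\<^sub>x - \<Delta>\<close>, hence
  \<open>\<bar>u \<bullet> H u\<bar> \<le> \<sigma>\<^sub>m\<^sub>a\<^sub>x - \<Delta> (1 - \<bar>v\<bar>\<^sup>2)\<close>. The angle condition gives
  \<open>\<bar>v\<bar>\<^sup>2 = u \<bullet> v \<le> (1 - \<epsilon>) \<bar>v\<bar>\<close>, that is \<open>\<bar>v\<bar> \<le> 1 - \<epsilon>\<close>, and \<open>1 - (1 - \<epsilon>)\<^sup>2 = 2 \<epsilon> - \<epsilon>\<^sup>2\<close>;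
  moreover \<open>\<sigma>\<^sub>m\<^sub>a\<^sub>x \<le> \<beta>\<^sub>f\<close> since \<open>\<sigma>\<^sub>m\<^sub>a\<^sub>x\<close> is at most the operator norm of \<open>H\<close>. This is
  \<open>symmetric_form_bound_by_spectral_gap\<close>, transferred to \<open>F\<close> in \<open>hess_graph_form_bound\<close>.

  The bounds on singular values come from a variational argument: the maximum of
  \<open>\<bar>A x\<bar>\<close> on the unit sphere of an invariant subspace of \<open>A\<^sup>* A\<close> is a singular value
  (\<open>singular_value_on_invariant_subspace\<close>). On the complement of the dominant subspace this
  singular value differs from \<open>\<sigma>\<^sub>m\<^sub>a\<^sub>x\<close>, so it is at most \<open>\<sigma>\<^sub>p\<^sub>+\<^sub>1\<close>.
  Symmetry of \<open>H\<close> is obtained from second differences (\<open>hess_symmetric\<close>).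

  Finally, the pullback metric \<open>R\<close> is constant, and the Riemannian gradient is \<open>R\<^sup>-\<^sup>1 \<nabla>F\<close>.
  Its Lipschitz constant is the bound \<open>\<beta>\<^sub>F\<close> on the form of \<open>\<nabla>\<^sup>2 F\<close> relative to \<open>R\<close>, by polarisation
  and the mean value theorem along segments (\<open>riem_lipschitz_on_riem_grad\<close>).\<close>


section \<open>Singular values and invariant subspaces\<close>

text \<open>The Rayleigh quotient of a symmetric operator attains its maximum on the unit sphere of an
  invariant subspace, and a maximiser is an eigenvector.\<close>

lemma symmetric_operator_max_eigenvector:
  fixes B :: "'a::euclidean_space \<Rightarrow> 'a"
  assumes B: "linear B" "\<And>x y. B x \<bullet> y = x \<bullet> B y"
    and V: "subspace V" "V \<noteq> {0}" "\<And>x. x \<in> V \<Longrightarrow> B x \<in> V"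
  obtains v where "v \<in> V" "norm v = 1" "B v = (v \<bullet> B v) *\<^sub>R v"
    "\<And>x. x \<in> V \<Longrightarrow> x \<bullet> B x \<le> (v \<bullet> B v) * (norm x)\<^sup>2"
proof -
  interpret B: linear B by fact
  let ?S = "V \<inter> sphere 0 1"
  obtain z where z: "z \<in> V" "z \<noteq> 0"
    using V(1,2) subspace_0 by blast
  have "(1 / norm z) *\<^sub>R z \<in> ?S"
    using z V(1) by (simp add: subspace_scale)
  then have "?S \<noteq> {}" by blast
  moreover have "compact ?S"
    using V(1) by (intro closed_Int_compact closed_subspace) auto
  moreover have "continuous_on ?S (\<lambda>x. x \<bullet> B x)"
    using B(1) by (intro continuous_intros linear_continuous_on) (simp add: linear_linear)
  ultimately obtain v where v: "v \<in> ?S" and max: "\<forall>x\<in>?S. x \<bullet> B x \<le> v \<bullet> B v"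
    using continuous_attains_sup[of ?S "\<lambda>x. x \<bullet> B x"] by meson
  define l where "l = v \<bullet> B v"
  have le: "x \<bullet> B x \<le> l * (norm x)\<^sup>2" if "x \<in> V" for x
  proof (cases "x = 0")
    case False
    have "(1 / norm x) *\<^sub>R x \<in> ?S"
      using False that V(1) by (simp add: subspace_scale)
    from max[rule_format, OF this] have "(x \<bullet> B x) / (norm x)\<^sup>2 \<le> l"
      by (simp add: B.scale l_def power2_eq_square)
    then show ?thesis using False by (simp add: divide_le_eq)
  qed (simp add: B.zero)
  define w where "w = B v - l *\<^sub>R v"
  have wV: "w \<in> V"
    using v V by (simp add: w_def subspace_diff subspace_scale)
  have vv: "v \<bullet> v = 1"
    using v by (simp add: dot_square_norm)
  \<comment> \<open>Stationarity of the Rayleigh quotient at \<open>v\<close> in the direction of the residual \<open>w\<close>.\<close>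
  have quad: "2 * t * (w \<bullet> w) \<le> t\<^sup>2 * (l * (w \<bullet> w) - w \<bullet> B w)" for t
  proof -
    have "v + t *\<^sub>R w \<in> V"
      using v wV V(1) by (simp add: subspace_add subspace_scale)
    from le[OF this]
    have "v \<bullet> B v + t * (v \<bullet> B w) + t * (w \<bullet> B v) + t\<^sup>2 * (w \<bullet> B w)
        \<le> l * (v \<bullet> v + 2 * t * (w \<bullet> v) + t\<^sup>2 * (w \<bullet> w))"
      unfolding power2_norm_eq_inner
      by (simp add: B.add B.scale inner_add_left inner_add_right inner_commute power2_eq_square
          algebra_simps)
    moreover have "v \<bullet> B w = w \<bullet> B v"
      using B(2)[of v w] by (simp add: inner_commute)
    moreover have "w \<bullet> B v - l * (w \<bullet> v) = w \<bullet> w"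
      by (subst (4) w_def) (simp add: inner_diff_right)
    ultimately show ?thesis
      by (simp add: vv l_def[symmetric] algebra_simps)
  qed
  have "w \<bullet> w = 0"
  proof (rule ccontr)
    assume "w \<bullet> w \<noteq> 0"
    then have pos: "w \<bullet> w > 0" by (simp add: inner_gt_zero_iff)
    \<comment> \<open>\<open>c\<close> is a positive bound of the quadratic coefficient, and \<open>t\<close> is small enough for the
    linear term to win.\<close>
    define c where "c = \<bar>l * (w \<bullet> w) - w \<bullet> B w\<bar> + 1"
    have c: "c > 0" "l * (w \<bullet> w) - w \<bullet> B w \<le> c" by (auto simp: c_def)
    define t where "t = (w \<bullet> w) / c"
    have t: "t > 0" using pos c by (simp add: t_def)
    have "2 * t * (w \<bullet> w) \<le> t\<^sup>2 * c"
      using quad[of t] mult_left_mono[OF c(2), of "t\<^sup>2"] by simp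
    then have "2 * (w \<bullet> w) \<le> t * c"
      using t by (simp add: power2_eq_square mult.assoc)
    then show False using pos c by (simp add: t_def)
  qed
  then have "B v = l *\<^sub>R v" by (simp add: w_def)
  then show thesis
    using that[of v] v le by (auto simp: l_def)
qed

text \<open>Applied to \<open>UNIV\<close>, this shows that singular values exist; applied to the orthogonal complement
  of a singular eigenspace, it bounds \<open>A\<close> there by another singular value.\<close>

lemma singular_value_on_invariant_subspace:
  fixes A :: "'a::euclidean_space \<Rightarrow> 'a"
  assumes A: "linear A"
    and V: "subspace V" "V \<noteq> {0}" "\<And>x. x \<in> V \<Longrightarrow> adjoint A (A x) \<in> V"
  obtains t v where "t \<in> singular_values A" "v \<in> V" "v \<noteq> 0" "adjoint A (A v) = t\<^sup>2 *\<^sub>R v"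
    "\<And>x. x \<in> V \<Longrightarrow> norm (A x) \<le> t * norm x"
proof -
  have "linear (\<lambda>x. adjoint A (A x))"
    using linear_compose[OF A adjoint_linear[OF A]] by (simp add: o_def)
  moreover have "adjoint A (A x) \<bullet> y = x \<bullet> adjoint A (A y)" for x y
    by (simp add: adjoint_clauses[OF A])
  ultimately obtain v where v: "v \<in> V" "norm v = 1"
    and eig: "adjoint A (A v) = (v \<bullet> adjoint A (A v)) *\<^sub>R v"
    and le: "\<And>x. x \<in> V \<Longrightarrow> x \<bullet> adjoint A (A x) \<le> (v \<bullet> adjoint A (A v)) * (norm x)\<^sup>2"
    using symmetric_operator_max_eigenvector[of "\<lambda>x. adjoint A (A x)" V] V by blast
  have sq: "x \<bullet> adjoint A (A x) = (norm (A x))\<^sup>2" for x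
    by (simp add: adjoint_clauses[OF A] power2_norm_eq_inner)
  have e: "adjoint A (A v) = (norm (A v))\<^sup>2 *\<^sub>R v"
    using eig by (simp add: sq)
  have "v \<noteq> 0" using v by auto
  moreover from this have "norm (A v) \<in> singular_values A"
    using e unfolding singular_values_def by auto
  moreover have "norm (A x) \<le> norm (A v) * norm x" if "x \<in> V" for x
    using le[OF that] by (simp add: sq power_mult_distrib[symmetric] abs_le_square_iff[symmetric] abs_mult)
  ultimately show thesis using that v(1) e by blast
qed

lemma subspace_singular_eigenspace:
  assumes "linear (A :: 'a::euclidean_space \<Rightarrow> 'a)"
  shows "subspace {v. adjoint A (A v) = s\<^sup>2 *\<^sub>R v}"
proof -
  interpret A: linear A by fact
  interpret A': linear "adjoint A" by (rule adjoint_linear) fact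
  show ?thesis
    by (auto simp: subspace_def A.zero A'.zero A.add A'.add A.scale A'.scale scaleR_add_right)
qed

lemma count_sing_list:
  fixes A :: "'a::euclidean_space \<Rightarrow> 'a"
  assumes A: "linear A"
  shows "count (mset (sing_list A)) s = (if s \<in> singular_values A then sing_mult A s else 0)"
  using finite_singular_values[OF A]
  by (simp add: sing_list_def count_sum )

lemma set_sing_list:
  fixes A :: "'a::euclidean_space \<Rightarrow> 'a"
  assumes A: "linear A"
  shows "set (sing_list A) = singular_values A"
proof -
  have "sing_mult A s \<noteq> 0" if "s \<in> singular_values A" for s
    using that by (auto simp: sing_mult_def singular_values_def)
  then show ?thesis
    using count_sing_list[OF A] by (metis count_mset_0_iff subsetI subset_antisym)
qed

lemma sorted_rev_sing_list: "sorted (rev (sing_list A))"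
  by (simp add: sing_list_def)

lemma sing_max_in_singular_values:
  fixes A :: "'a::euclidean_space \<Rightarrow> 'a"
  assumes A: "linear A"
  shows "sing_max A \<in> singular_values A"
proof -
  have "(UNIV::'a set) \<noteq> {0}"
    by (rule UNIV_not_singleton)
  then obtain t where "t \<in> singular_values A"
    using singular_value_on_invariant_subspace[OF A subspace_UNIV] by blast
  then have "sing_list A \<noteq> []"
    using set_sing_list[OF A] by auto
  then show ?thesis
    using nth_mem[of 0 "sing_list A"] by (simp add: sing_val_def set_sing_list[OF A])
qed

text \<open>In a descending list, the copies of the maximum form an initial block; the entry after it is
  an upper bound of all smaller values.\<close>

lemma le_nth_count_of_descending:
  fixes xs :: "'b::linorder list"
  assumes sorted: "sorted (rev xs)" and t: "t \<in> set xs" "t \<noteq> xs ! 0"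
  shows "t \<le> xs ! count (mset xs) (xs ! 0)"
proof -
  obtain j where j: "j < length xs" "xs ! j = t"
    using t(1) by (auto simp: in_set_conv_nth)
  have mono: "xs ! k \<le> xs ! i" if "i \<le> k" "k < length xs" for i k
    using sorted_rev_nth_mono[OF sorted that] .
  \<comment> \<open>Otherwise \<open>t = xs ! j\<close> would lie between two copies of the maximum.\<close>
  have less: "i < j" if "i < length xs" "xs ! i = xs ! 0" for i
  proof (rule ccontr)
    assume "\<not> i < j"
    then have "xs ! 0 \<le> xs ! j" using mono[of j i] that by simp
    with mono[of 0 j] j t(2) show False by simp
  qed
  have "count (mset xs) (xs ! 0) = card {i. i < length xs \<and> xs ! 0 = xs ! i}"
    by (simp add: count_mset count_list_eq_length_filter length_filter_conv_card)
  also have "\<dots> \<le> card {..<j}"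
    using less by (intro card_mono) auto
  finally show ?thesis
    using mono[of _ j] j by simp
qed

lemma singular_value_le_sing_val:
  fixes A :: "'a::euclidean_space \<Rightarrow> 'a"
  assumes A: "linear A" and t: "t \<in> singular_values A" "t \<noteq> sing_max A"
  shows "t \<le> sing_val A (sing_mult A (sing_max A) + 1)"
  using le_nth_count_of_descending[OF sorted_rev_sing_list, of t A] t
    sing_max_in_singular_values[OF A]
  by (simp add: set_sing_list[OF A] count_sing_list[OF A] sing_val_def)

lemma sing_max_le_onorm:
  fixes A :: "'a::euclidean_space \<Rightarrow> 'a"
  assumes A: "linear A"
  shows "sing_max A \<le> onorm A"
proof -
  obtain v where v: "v \<noteq> 0" "adjoint A (A v) = (sing_max A)\<^sup>2 *\<^sub>R v"
    and s: "0 \<le> sing_max A"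
    using sing_max_in_singular_values[OF A] by (auto simp: singular_values_def)
  have "A v \<bullet> A v = v \<bullet> adjoint A (A v)"
    by (simp add: adjoint_clauses[OF A])
  then have "(norm (A v))\<^sup>2 = (sing_max A * norm v)\<^sup>2"
    by (simp add: v(2) power2_norm_eq_inner power_mult_distrib)
  then have "norm (A v) = sing_max A * norm v"
    using s by simp
  then show ?thesis
    using onorm[of A v] A v(1) by (simp add: linear_linear)
qed

lemma adjoint_symmetric:
  assumes "\<And>x y. A x \<bullet> y = x \<bullet> A y"
  shows "adjoint A = A"
  using adjoint_unique[of A A] assms by blast

text \<open>For a symmetric operator the span of the eigenvectors for \<open>\<plusminus>\<sigma>\<^sub>m\<^sub>a\<^sub>x\<close> is the whole eigenspace of
  \<open>A\<^sup>2\<close> for \<open>\<sigma>\<^sub>m\<^sub>a\<^sub>x\<^sup>2\<close>, whose dimension is the multiplicity of \<open>\<sigma>\<^sub>m\<^sub>a\<^sub>x\<close>.\<close>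

lemma dominant_subspace_symmetric:
  fixes A :: "'a::euclidean_space \<Rightarrow> 'a"
  assumes A: "linear A" and sym: "\<And>x y. A x \<bullet> y = x \<bullet> A y"
  shows "dominant_subspace A = {v. A (A v) = (sing_max A)\<^sup>2 *\<^sub>R v}" (is "_ = ?E")
proof
  interpret A: linear A by fact
  have adj: "adjoint A = A" using adjoint_symmetric[OF sym] .
  let ?s = "sing_max A"
  let ?G = "{v. \<exists>l. A v = l *\<^sub>R v \<and> \<bar>l\<bar> = ?s}"
  have "?G \<subseteq> ?E"
  proof clarify
    fix v l assume v: "A v = l *\<^sub>R v" and l: "\<bar>l\<bar> = ?s"
    have "A (A v) = l\<^sup>2 *\<^sub>R v" by (simp add: v A.scale power2_eq_square)
    also have "l\<^sup>2 = ?s\<^sup>2" by (metis l power2_abs)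
    finally show "A (A v) = ?s\<^sup>2 *\<^sub>R v" .
  qed
  moreover have "subspace ?E"
    using subspace_singular_eigenspace[OF A, of ?s] by (simp add: adj)
  ultimately show "dominant_subspace A \<subseteq> ?E"
    unfolding dominant_subspace_def by (rule span_minimal)
  show "?E \<subseteq> dominant_subspace A"
  proof
    fix v assume v: "v \<in> ?E"
    have s0: "0 \<le> ?s"
      using sing_max_in_singular_values[OF A] by (simp add: singular_values_def)
    show "v \<in> dominant_subspace A"
    proof (cases "?s = 0")
      case True
      have "A v \<bullet> A v = v \<bullet> A (A v)" by (simp add: sym)
      then have "A v = 0" using v True by simp
      then have "v \<in> ?G" using True by auto
      then show ?thesis unfolding dominant_subspace_def by (rule span_base)
    next
      case False
      \<comment> \<open>\<open>v\<close> is half the sum of \<open>v + A v / s\<close> and \<open>v - A v / s\<close>, eigenvectors for \<open>s\<close> and \<open>- s\<close>.\<close>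
      have "A (v + (1 / ?s) *\<^sub>R A v) = ?s *\<^sub>R (v + (1 / ?s) *\<^sub>R A v)"
        and "A (v - (1 / ?s) *\<^sub>R A v) = (- ?s) *\<^sub>R (v - (1 / ?s) *\<^sub>R A v)"
        using v False
        by (simp_all add: A.add A.diff A.scale scaleR_add_right scaleR_diff_right power2_eq_square)
      then have "v + (1 / ?s) *\<^sub>R A v \<in> ?G" "v - (1 / ?s) *\<^sub>R A v \<in> ?G"
        using s0 by (metis (mono_tags, lifting) abs_minus_cancel abs_of_nonneg mem_Collect_eq)+
      then have "(1/2) *\<^sub>R ((v + (1 / ?s) *\<^sub>R A v) + (v - (1 / ?s) *\<^sub>R A v)) \<in> span ?G"
        by (intro span_scale span_add span_base)
      then show ?thesis
        by (simp add: dominant_subspace_def scaleR_2[symmetric])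
    qed
  qed
qed

text \<open>A vector \<open>u\<close> at a positive angle from the dominant subspace cannot see the full norm of \<open>A\<close>.
  If \<open>u\<close> is nonzero, the angle condition with \<open>c < 1\<close> also excludes that the dominant subspace is
  everything, in which case the index after the multiplicity would lie outside the list of
  singular values.\<close>

lemma symmetric_form_bound_by_spectral_gap:
  fixes A :: "'a::euclidean_space \<Rightarrow> 'a"
  assumes A: "linear A" and sym: "\<And>x y. A x \<bullet> y = x \<bullet> A y"
    and gap: "0 \<le> d" "d \<le> sing_max A - sing_val A (sing_mult A (sing_max A) + 1)"
    and c: "0 \<le> c" "c < 1"
    and angle: "\<And>v. v \<in> dominant_subspace A \<Longrightarrow> \<bar>u \<bullet> v\<bar> \<le> c * norm u * norm v"
  shows "\<bar>u \<bullet> A u\<bar> \<le> (sing_max A - d * (1 - c\<^sup>2)) * (norm u)\<^sup>2"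
proof (cases "u = 0")
  case True
  then show ?thesis using A by (simp add: linear_0)
next
  case False
  interpret A: linear A by fact
  have adj: "adjoint A = A" using adjoint_symmetric[OF sym] .
  define s where "s = sing_max A"
  define E where "E = dominant_subspace A"
  have E: "E = {v. A (A v) = s\<^sup>2 *\<^sub>R v}"
    unfolding E_def s_def by (rule dominant_subspace_symmetric[OF A sym])
  have subE: "subspace E" by (simp add: E_def dominant_subspace_def)
  have s0: "0 \<le> s"
    using sing_max_in_singular_values[OF A] by (simp add: singular_values_def s_def)
  let ?W = "E\<^sup>\<bottom>"
  have W: "x \<in> ?W \<longleftrightarrow> (\<forall>y\<in>E. y \<bullet> x = 0)" for x
    by (simp add: orthogonal_comp_def orthogonal_def)
  obtain v w where vw: "v \<in> E" "w \<in> ?W" "u = v + w"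
    using orthogonal_subspace_decomp_exists[of E u] subE
    by (metis W inner_commute orthogonal_def span_eq_iff)
  have vw0: "v \<bullet> w = 0" using vw W by blast
  \<comment> \<open>The angle condition applied to the component \<open>v\<close> of \<open>u\<close> itself.\<close>
  have "(norm v)\<^sup>2 = u \<bullet> v"
    using vw0 by (simp add: vw(3) inner_add_left power2_norm_eq_inner inner_commute[of w])
  also have "\<dots> \<le> c * norm u * norm v"
    using angle[of v] vw(1) by (simp add: E_def)
  finally have nv: "norm v \<le> c * norm u"
    using c by (cases "v = 0") (simp_all add: power2_eq_square)
  \<comment> \<open>This makes the complement of the dominant subspace nontrivial, so that \<open>A\<close> has a singular
    value there.\<close>
  have "w \<noteq> 0"
  proof
    assume "w = 0"
    then have "1 * norm u \<le> c * norm u" using nv vw(3) by simp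
    then show False using c False by (simp only: mult_le_cancel_right) auto
  qed
  then have "?W \<noteq> {0}" using vw(2) by blast
  moreover have "adjoint A (A x) \<in> ?W" if "x \<in> ?W" for x
  proof -
    have "y \<bullet> A (A x) = 0" if "y \<in> E" for y
    proof -
      have "y \<bullet> A (A x) = A (A y) \<bullet> x" by (simp add: sym)
      also have "\<dots> = s\<^sup>2 * (y \<bullet> x)" using that by (simp add: E)
      also have "\<dots> = 0" using that \<open>x \<in> ?W\<close> W by simp
      finally show ?thesis .
    qed
    then show ?thesis by (simp add: W adj)
  qed
  ultimately obtain t z where t: "t \<in> singular_values A" "z \<in> ?W" "z \<noteq> 0"
      "adjoint A (A z) = t\<^sup>2 *\<^sub>R z"
    and At: "\<And>x. x \<in> ?W \<Longrightarrow> norm (A x) \<le> t * norm x"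
    using singular_value_on_invariant_subspace[OF A subspace_orthogonal_comp] by blast
  have "t \<noteq> s"
  proof
    assume "t = s"
    then have "z \<in> E" using t(4) by (simp add: E adj)
    then have "z \<bullet> z = 0" using t(2) W by blast
    then show False using t(3) by simp
  qed
  then have ts: "t \<le> s - d"
    using singular_value_le_sing_val[OF A t(1)] gap(2) by (simp add: s_def)
  have "(norm (A v))\<^sup>2 = (s * norm v)\<^sup>2"
    using vw(1) by (simp add: power2_norm_eq_inner sym E power_mult_distrib)
  then have Av: "norm (A v) = s * norm v"
    using s0 by simp
  have "A v \<in> E" using vw(1) by (simp add: E A.scale)
  then have "w \<bullet> A v = 0" "v \<bullet> A w = 0"
    using vw(2) W sym[of v w] by (auto simp: inner_commute)
  then have "\<bar>u \<bullet> A u\<bar> = \<bar>v \<bullet> A v + w \<bullet> A w\<bar>"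
    by (simp add: vw(3) A.add inner_add_left inner_add_right)
  also have "\<dots> \<le> norm v * norm (A v) + norm w * norm (A w)"
    by (intro order.trans[OF abs_triangle_ineq] add_mono Cauchy_Schwarz_ineq2)
  also have "\<dots> \<le> norm v * (s * norm v) + norm w * ((s - d) * norm w)"
    using At[OF vw(2)] Av mult_right_mono[OF ts, of "norm w"]
    by (intro add_mono mult_left_mono) auto
  also have "\<dots> = s * ((norm v)\<^sup>2 + (norm w)\<^sup>2) - d * (norm w)\<^sup>2"
    by (simp add: power2_eq_square algebra_simps)
  also have "(norm v)\<^sup>2 + (norm w)\<^sup>2 = (norm u)\<^sup>2"
    using vw0 by (simp add: vw(3) norm_add_Pythagorean orthogonal_def)
  finally have "\<bar>u \<bullet> A u\<bar> \<le> s * (norm u)\<^sup>2 - d * (norm w)\<^sup>2" .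
  moreover have "d * ((1 - c\<^sup>2) * (norm u)\<^sup>2) \<le> d * (norm w)\<^sup>2"
  proof (intro mult_left_mono gap(1))
    have "(norm v)\<^sup>2 \<le> (c * norm u)\<^sup>2"
      using nv by (intro power_mono) auto
    moreover have "(norm w)\<^sup>2 = (norm u)\<^sup>2 - (norm v)\<^sup>2"
      using vw0 by (simp add: vw(3) norm_add_Pythagorean orthogonal_def)
    ultimately show "(1 - c\<^sup>2) * (norm u)\<^sup>2 \<le> (norm w)\<^sup>2"
      by (simp add: power_mult_distrib algebra_simps)
  qed
  ultimately show ?thesis
    by (simp add: s_def algebra_simps)
qed

section \<open>Gradients and Hessians\<close>

lemma has_derivative_grad:
  fixes f :: "'a::euclidean_space \<Rightarrow> real"
  assumes "f differentiable (at x)"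
  shows "(f has_derivative (\<lambda>h. h \<bullet> grad f x)) (at x)"
proof -
  define D where "D = frechet_derivative f (at x)"
  have D: "(f has_derivative D) (at x)"
    using assms unfolding D_def by (simp add: frechet_derivative_works)
  then have lin: "linear D" by (rule has_derivative_linear)
  have "D = (\<lambda>h. h \<bullet> adjoint D 1)"
    by (simp add: fun_eq_iff adjoint_works[OF lin])
  then have g: "GDERIV f x :> adjoint D 1"
    using D by (simp add: gderiv_def)
  moreover have "g = adjoint D 1" if "GDERIV f x :> g" for g
  proof -
    have "(\<lambda>h. h \<bullet> g) = (\<lambda>h. h \<bullet> adjoint D 1)"
      using that g unfolding gderiv_def by (rule has_derivative_unique)
    then show ?thesis by (metis vector_eq_ldot)
  qed
  ultimately have "GDERIV f x :> grad f x"
    unfolding grad_def by (rule theI)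
  then show ?thesis by (simp add: gderiv_def)
qed

lemma grad_eqI:
  fixes f :: "'a::euclidean_space \<Rightarrow> real"
  assumes "(f has_derivative (\<lambda>h. h \<bullet> g)) (at x)"
  shows "grad f x = g"
proof -
  have "(\<lambda>h. h \<bullet> grad f x) = (\<lambda>h. h \<bullet> g)"
    using has_derivative_grad assms by (metis differentiableI has_derivative_unique)
  then show ?thesis by (metis vector_eq_ldot)
qed

lemma has_derivative_hess:
  assumes "grad f differentiable (at x)"
  shows "(grad f has_derivative hess f x) (at x)"
  using assms unfolding hess_def by (simp add: frechet_derivative_works)

lemma DERIV_inner_along_line:
  fixes g :: "'a::real_normed_vector \<Rightarrow> 'b::real_inner"
  assumes "(g has_derivative G) (at (x + t *\<^sub>R w))"
  shows "((\<lambda>t. d \<bullet> g (x + t *\<^sub>R w)) has_real_derivative d \<bullet> G w) (at t)"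
proof -
  interpret G: linear G using assms by (rule has_derivative_linear)
  have "((\<lambda>t. x + t *\<^sub>R w) has_derivative (\<lambda>h. h *\<^sub>R w)) (at t)"
    by (auto intro!: derivative_eq_intros)
  from has_derivative_inner_right[OF has_derivative_compose[OF this assms], of d]
  show ?thesis
    by (simp add: has_field_derivative_def G.scale mult.commute[of _ "d \<bullet> G w"])
qed

text \<open>The expression on the left is symmetric in \<open>u\<close> and \<open>v\<close>; two applications of the mean value
  theorem, first in the direction \<open>u\<close> and then in the direction \<open>v\<close>, express it by the Hessian
  at a nearby point.\<close>

lemma second_difference_mean_value:
  fixes f :: "'a::euclidean_space \<Rightarrow> real"
  assumes f: "\<And>x. f differentiable (at x)" "\<And>x. grad f differentiable (at x)"
    and s: "0 < s"
  obtains a b where "0 < a" "a < s" "0 < b" "b < s"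
    "f (x + s *\<^sub>R u + s *\<^sub>R v) - f (x + s *\<^sub>R u) - f (x + s *\<^sub>R v) + f x
      = s\<^sup>2 * (u \<bullet> hess f (x + a *\<^sub>R u + b *\<^sub>R v) v)"
proof -
  define g where "g a = f (x + s *\<^sub>R v + a *\<^sub>R u) - f (x + a *\<^sub>R u)" for a
  have df: "((\<lambda>a. f (z + a *\<^sub>R u)) has_real_derivative u \<bullet> grad f (z + a *\<^sub>R u)) (at a)" for z a
    using DERIV_inner_along_line[OF has_derivative_grad[OF f(1)], of 1] by simp
  have "(g has_real_derivative
      u \<bullet> grad f (x + s *\<^sub>R v + a *\<^sub>R u) - u \<bullet> grad f (x + a *\<^sub>R u)) (at a)" for a
    unfolding g_def by (intro DERIV_diff df)
  from MVT2[OF s this] obtain a where a: "0 < a" "a < s"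
    and ga: "g s - g 0 =
      s * (u \<bullet> grad f (x + s *\<^sub>R v + a *\<^sub>R u) - u \<bullet> grad f (x + a *\<^sub>R u))"
    by auto
  define k where "k b = u \<bullet> grad f (x + a *\<^sub>R u + b *\<^sub>R v)" for b
  have "(k has_real_derivative u \<bullet> hess f (x + a *\<^sub>R u + b *\<^sub>R v) v) (at b)" for b
    unfolding k_def by (intro DERIV_inner_along_line has_derivative_hess f)
  from MVT2[OF s this] obtain b where b: "0 < b" "b < s"
    and kb: "k s - k 0 = s * (u \<bullet> hess f (x + a *\<^sub>R u + b *\<^sub>R v) v)"
    by auto
  have "f (x + s *\<^sub>R u + s *\<^sub>R v) - f (x + s *\<^sub>R u) - f (x + s *\<^sub>R v) + f x = g s - g 0"
    by (simp add: g_def add.assoc add.commute[of "s *\<^sub>R u"])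
  also have "\<dots> = s * (k s - k 0)"
    by (simp add: ga k_def add.assoc add.commute[of "a *\<^sub>R u"])
  also have "\<dots> = s\<^sup>2 * (u \<bullet> hess f (x + a *\<^sub>R u + b *\<^sub>R v) v)"
    by (simp add: kb power2_eq_square)
  finally show thesis using that a b by blast
qed

lemma hess_symmetric:
  fixes f :: "'a::euclidean_space \<Rightarrow> real"
  assumes f: "C2 f"
  shows "hess f x u \<bullet> v = u \<bullet> hess f x v"
proof -
  have d: "f differentiable (at y)" "grad f differentiable (at y)" for y
    using f by (auto simp: C2_def)
  define s :: "nat \<Rightarrow> real" where "s n = 1 / real (Suc n)" for n
  have s0: "s \<longlonglongrightarrow> 0" and pos: "0 < s n" for n
    unfolding s_def using LIMSEQ_inverse_real_of_nat by (simp_all add: inverse_eq_divide)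
  define Q where "Q n u v = f (x + s n *\<^sub>R u + s n *\<^sub>R v) - f (x + s n *\<^sub>R u) - f (x + s n *\<^sub>R v) + f x"
    for n u v
  have lim: "(\<lambda>n. Q n u v / (s n)\<^sup>2) \<longlonglongrightarrow> u \<bullet> hess f x v" for u v
  proof -
    have "\<exists>a b. 0 < a \<and> a < s n \<and> 0 < b \<and> b < s n \<and>
        Q n u v = (s n)\<^sup>2 * (u \<bullet> hess f (x + a *\<^sub>R u + b *\<^sub>R v) v)" for n
      unfolding Q_def using second_difference_mean_value[OF d pos[of n], of x u v] by metis
    then obtain a b where ab: "\<And>n. 0 < a n \<and> a n < s n \<and> 0 < b n \<and> b n < s n"
      and Q: "\<And>n. Q n u v = (s n)\<^sup>2 * (u \<bullet> hess f (x + a n *\<^sub>R u + b n *\<^sub>R v) v)"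
      by metis
    have "a \<longlonglongrightarrow> 0" "b \<longlonglongrightarrow> 0"
      using ab by (auto intro!: real_tendsto_sandwich[OF _ _ tendsto_const s0] eventuallyI less_imp_le)
    then have "(\<lambda>n. x + a n *\<^sub>R u + b n *\<^sub>R v) \<longlonglongrightarrow> x + 0 *\<^sub>R u + 0 *\<^sub>R v"
      by (intro tendsto_intros)
    then have "(\<lambda>n. hess f (x + a n *\<^sub>R u + b n *\<^sub>R v) v) \<longlonglongrightarrow> hess f x v"
      using f by (intro isCont_tendsto_compose[where g = "\<lambda>y. hess f y v"])
        (auto simp: C2_def continuous_on_eq_continuous_at)
    then have "(\<lambda>n. u \<bullet> hess f (x + a n *\<^sub>R u + b n *\<^sub>R v) v) \<longlonglongrightarrow> u \<bullet> hess f x v"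
      by (intro tendsto_intros)
    moreover have "Q n u v / (s n)\<^sup>2 = u \<bullet> hess f (x + a n *\<^sub>R u + b n *\<^sub>R v) v" for n
      using pos[of n] by (simp add: Q)
    ultimately show ?thesis by simp
  qed
  have "Q n u v = Q n v u" for n
    by (simp add: Q_def algebra_simps)
  then have "u \<bullet> hess f x v = v \<bullet> hess f x u"
    using LIMSEQ_unique[OF lim[of u v]] lim[of v u] by simp
  then show ?thesis by (simp add: inner_commute)
qed

text \<open>Continuity of \<open>A\<close> vector by vector suffices, because the operator norm is at most the sum
  of the norms of the images of the basis vectors.\<close>

lemma bdd_above_onorm_compact:
  fixes A :: "'c::topological_space \<Rightarrow> 'a::euclidean_space \<Rightarrow> 'b::real_normed_vector"
  assumes K: "compact K" and A: "\<And>x. linear (A x)" "\<And>v. continuous_on K (\<lambda>x. A x v)"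
  shows "bdd_above ((\<lambda>x. onorm (A x)) ` K)"
proof -
  have "bounded ((\<lambda>x. \<Sum>b\<in>Basis. norm (A x b)) ` K)"
    by (intro compact_imp_bounded compact_continuous_image continuous_intros A K)
  then obtain M where M: "\<And>x. x \<in> K \<Longrightarrow> (\<Sum>b\<in>Basis. norm (A x b)) \<le> M"
    unfolding bounded_real by (metis abs_le_D1 image_eqI)
  have "onorm (A x) \<le> M" if "x \<in> K" for x
  proof -
    interpret A: linear "A x" by (rule A)
    have "norm (A x y) \<le> (\<Sum>b\<in>Basis. norm (A x b)) * norm y" for y
    proof -
      have "A x y = (\<Sum>b\<in>Basis. (y \<bullet> b) *\<^sub>R A x b)"
        by (subst euclidean_representation[of y, symmetric]) (simp only: A.sum A.scale)
      also have "norm \<dots> \<le> (\<Sum>b\<in>Basis. norm (A x b) * norm y)"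
        by (intro sum_norm_le)
          (simp add: mult.commute[of _ "norm y"] mult_right_mono Basis_le_norm)
      finally show ?thesis by (simp add: sum_distrib_right)
    qed
    then show ?thesis
      using M[OF that] by (intro onorm_le) (meson mult_right_mono norm_ge_zero order_trans)
  qed
  then show ?thesis by (intro bdd_aboveI2)
qed

lemma grad_hess_comp_affine:
  fixes f :: "'b::euclidean_space \<Rightarrow> real" and \<Phi> :: "'a::euclidean_space \<Rightarrow> 'b"
  assumes f: "\<And>x. f differentiable (at x)" "\<And>x. grad f differentiable (at x)"
    and \<Phi>: "\<And>x. (\<Phi> has_derivative D) (at x)"
  shows has_derivative_comp_affine:
      "(f \<circ> \<Phi> has_derivative (\<lambda>h. h \<bullet> grad (f \<circ> \<Phi>) x)) (at x)"
    and has_derivative_grad_comp_affine: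
      "(grad (f \<circ> \<Phi>) has_derivative hess (f \<circ> \<Phi>) x) (at x)"
    and hess_comp_affine:
      "hess (f \<circ> \<Phi>) x = (\<lambda>h. adjoint D (hess f (\<Phi> x) (D h)))"
proof -
  have D: "linear D" using \<Phi> by (rule has_derivative_linear)
  have d: "(f \<circ> \<Phi> has_derivative (\<lambda>h. h \<bullet> adjoint D (grad f (\<Phi> x)))) (at x)" for x
    using has_derivative_compose[OF \<Phi> has_derivative_grad[OF f(1)]]
    by (simp add: o_def adjoint_works[OF D])
  have g: "grad (f \<circ> \<Phi>) = (\<lambda>x. adjoint D (grad f (\<Phi> x)))"
    using grad_eqI[OF d] by blast
  show "(f \<circ> \<Phi> has_derivative (\<lambda>h. h \<bullet> grad (f \<circ> \<Phi>) x)) (at x)"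
    using d by (simp add: g)
  have h: "(grad (f \<circ> \<Phi>) has_derivative (\<lambda>h. adjoint D (hess f (\<Phi> x) (D h)))) (at x)"
    unfolding g
    using bounded_linear.has_derivative[OF _ has_derivative_compose[OF \<Phi> has_derivative_hess[OF f(2)]]]
      adjoint_linear[OF D] by (simp add: linear_linear)
  show e: "hess (f \<circ> \<Phi>) x = (\<lambda>h. adjoint D (hess f (\<Phi> x) (D h)))"
    unfolding hess_def[of "f \<circ> \<Phi>"] using frechet_derivative_at[OF h] by simp
  show "(grad (f \<circ> \<Phi>) has_derivative hess (f \<circ> \<Phi>) x) (at x)"
    using h by (simp add: e)
qed

section \<open>The norm of a symmetric form and Lipschitz continuity of the Riemannian gradient\<close>

text \<open>A bound of a symmetric form on the diagonal, relative to an inner product \<open>R\<close>, bounds the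
  bilinear form by the same constant.\<close>

lemma symmetric_form_Cauchy_Schwarz:
  fixes H R :: "'a::euclidean_space \<Rightarrow> 'a"
  assumes H: "linear H" "\<And>x y. H x \<bullet> y = x \<bullet> H y"
    and R: "linear R" "\<And>x y. R x \<bullet> y = x \<bullet> R y" "\<And>y. y \<noteq> 0 \<Longrightarrow> 0 < y \<bullet> R y"
    and bound: "\<And>y. \<bar>y \<bullet> H y\<bar> \<le> B * (y \<bullet> R y)"
  shows "d \<bullet> H h \<le> B * (norm_wrt R d * norm_wrt R h)"
proof (cases "d = 0 \<or> h = 0")
  case True
  then show ?thesis
    using linear_0[OF H(1)] by (auto simp: norm_wrt_def inner_wrt_def)
next
  case False
  interpret H: linear H by fact
  interpret R: linear R by fact
  define a b where "a = norm_wrt R d" and "b = norm_wrt R h"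
  have ab: "0 < a" "0 < b" "a\<^sup>2 = d \<bullet> R d" "b\<^sup>2 = h \<bullet> R h"
    using R(3)[of d] R(3)[of h] False by (auto simp: a_def b_def norm_wrt_def inner_wrt_def)
  define y z where "y = (1 / a) *\<^sub>R d" and "z = (1 / b) *\<^sub>R h"
  have yz: "y \<bullet> R y = 1" "z \<bullet> R z = 1"
    using ab by (simp_all add: y_def z_def R.scale power2_eq_square flip: ab(3,4))
  \<comment> \<open>Polarisation for the normalised vectors.\<close>
  have "4 * (y \<bullet> H z) = (y + z) \<bullet> H (y + z) - (y - z) \<bullet> H (y - z)"
    using H(2)[of z y]
    by (simp add: H.add H.diff inner_add_left inner_add_right inner_diff_left inner_diff_right
        inner_commute)
  also have "\<dots> \<le> B * ((y + z) \<bullet> R (y + z)) + B * ((y - z) \<bullet> R (y - z))"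
    using bound[of "y + z"] bound[of "y - z"] by linarith
  also have "\<dots> = B * (2 * (y \<bullet> R y) + 2 * (z \<bullet> R z))"
    by (simp add: R.add R.diff inner_add_left inner_add_right inner_diff_left inner_diff_right
        algebra_simps)
  finally have "y \<bullet> H z \<le> B" by (simp add: yz)
  then have "(d \<bullet> H h) / (a * b) \<le> B"
    by (simp add: y_def z_def H.scale mult.commute)
  then show ?thesis
    using ab by (simp add: divide_le_eq a_def[symmetric] b_def[symmetric])
qed

lemma riem_grad_represents:
  fixes F :: "'a::euclidean_space \<Rightarrow> real"
  assumes R: "linear (R x)" "\<And>u v. R x u \<bullet> v = u \<bullet> R x v" "\<And>y. y \<noteq> 0 \<Longrightarrow> 0 < y \<bullet> R x y"
    and F: "(F has_derivative (\<lambda>h. h \<bullet> grad F x)) (at x)"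
  shows "R x (riem_grad R F x) = grad F x"
proof -
  interpret R: linear "R x" by fact
  have "u = 0" if "R x u = 0" for u
    using R(3)[of u] that by force
  then have inj: "inj (R x)"
    by (simp add: R.inj_iff_eq_0)
  then have "surj (R x)"
    using R(1) by (simp add: linear_injective_imp_surjective)
  then obtain g0 where g0: "R x g0 = grad F x" by (metis surjD)
  have eq: "(\<forall>v. inner_wrt (R x) g v = frechet_derivative F (at x) v) \<longleftrightarrow> g = g0" for g
  proof -
    have "(\<forall>v. inner_wrt (R x) g v = frechet_derivative F (at x) v) \<longleftrightarrow> (\<forall>v. R x g \<bullet> v = R x g0 \<bullet> v)"
      by (simp add: inner_wrt_def R(2)[symmetric] frechet_derivative_at[OF F, symmetric] g0
          inner_commute[of _ "grad F x"])
    also have "\<dots> \<longleftrightarrow> R x g = R x g0" by (metis vector_eq_rdot)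
    also have "\<dots> \<longleftrightarrow> g = g0" using inj by (simp add: inj_eq)
    finally show ?thesis .
  qed
  show ?thesis by (simp add: riem_grad_def eq g0)
qed

text \<open>The segment between two points of \<open>D\<close> is a geodesic since \<open>R\<close> is constant. Testing the
  difference \<open>d\<close> of the gradients at its ends against \<open>d\<close> itself reduces the claim to the
  mean value theorem for a real function.\<close>

lemma riem_lipschitz_on_riem_grad:
  fixes F :: "'a::euclidean_space \<Rightarrow> real"
  assumes const: "\<And>x. R x = R0"
    and R0: "linear R0" "\<And>x y. R0 x \<bullet> y = x \<bullet> R0 y" "\<And>y. y \<noteq> 0 \<Longrightarrow> 0 < y \<bullet> R0 y"
    and F: "\<And>x. (F has_derivative (\<lambda>h. h \<bullet> grad F x)) (at x)"
      "\<And>x. (grad F has_derivative hess F x) (at x)"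
      "\<And>x u v. hess F x u \<bullet> v = u \<bullet> hess F x v"
    and B: "0 \<le> B" "\<And>x y. x \<in> D \<Longrightarrow> \<bar>y \<bullet> hess F x y\<bar> \<le> B * (y \<bullet> R0 y)"
  shows "riem_lipschitz_on B R D (riem_grad R F)"
proof -
  let ?G = "riem_grad R F"
  have "norm_wrt R0 (?G y - ?G x) \<le> B * norm_wrt R0 (y - x)"
    if seg: "closed_segment x y \<subseteq> D" for x y
  proof -
    define d where "d = ?G y - ?G x"
    have R0G: "R0 (?G z) = grad F z" for z
      using riem_grad_represents[of R z F] R0 F(1) by (simp add: const)
    define k where "k t = d \<bullet> grad F (x + t *\<^sub>R (y - x))" for t
    have "(k has_real_derivative d \<bullet> hess F (x + t *\<^sub>R (y - x)) (y - x)) (at t)" for t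
      unfolding k_def by (intro DERIV_inner_along_line F)
    from MVT2[OF zero_less_one this] obtain t where t: "0 < t" "t < 1"
      and kt: "k 1 - k 0 = d \<bullet> hess F (x + t *\<^sub>R (y - x)) (y - x)"
      by auto
    have "x + t *\<^sub>R (y - x) \<in> closed_segment x y"
      using t by (auto simp: in_segment algebra_simps intro!: exI[of _ t])
    then have zD: "x + t *\<^sub>R (y - x) \<in> D" using seg by blast
    have "(norm_wrt R0 d)\<^sup>2 = d \<bullet> R0 d"
      using R0(3)[of d] by (cases "d = 0") (auto simp: norm_wrt_def inner_wrt_def)
    also have "\<dots> = k 1 - k 0"
      by (simp add: d_def k_def linear_diff[OF R0(1)] R0G inner_diff_right)
    also have "\<dots> \<le> B * (norm_wrt R0 d * norm_wrt R0 (y - x))"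
      unfolding kt using has_derivative_linear[OF F(2)] F(3) R0 B(2)[OF zD]
      by (rule symmetric_form_Cauchy_Schwarz)
    finally have "norm_wrt R0 d * norm_wrt R0 d \<le> norm_wrt R0 d * (B * norm_wrt R0 (y - x))"
      by (simp add: power2_eq_square mult.left_commute)
    moreover have "0 \<le> norm_wrt R0 z" for z
      using R0(3)[of z] by (cases "z = 0") (auto simp: norm_wrt_def inner_wrt_def)
    ultimately show ?thesis
      unfolding d_def[symmetric] using B(1)
      by (metis mult_le_cancel_left mult_nonneg_nonneg order_le_less)
  qed
  then show ?thesis
    unfolding riem_lipschitz_on_def const using B(1) by blast
qed

lemma form_norm_wrt_bounds:
  fixes H R :: "'a::euclidean_space \<Rightarrow> 'a"
  assumes R: "\<And>y. y \<noteq> 0 \<Longrightarrow> 0 < y \<bullet> R y" and H: "linear H"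
    and c: "\<And>y. \<bar>y \<bullet> H y\<bar> \<le> c * (y \<bullet> R y)"
  shows form_norm_wrt_le: "form_norm_wrt R H \<le> c"
    and form_norm_wrt_nonneg: "0 \<le> form_norm_wrt R H"
    and form_le_form_norm_wrt: "\<bar>y \<bullet> H y\<bar> \<le> form_norm_wrt R H * (y \<bullet> R y)"
proof -
  have le: "\<bar>y \<bullet> H y\<bar> / (y \<bullet> R y) \<le> c" if "y \<noteq> 0" for y
    using c[of y] R[OF that] by (simp add: divide_le_eq)
  have ne: "-{0::'a} \<noteq> {}"
    using UNIV_not_singleton[of "0::'a"] by blast
  show "form_norm_wrt R H \<le> c"
    unfolding form_norm_wrt_def using le ne by (intro cSUP_least) auto
  have up: "\<bar>y \<bullet> H y\<bar> / (y \<bullet> R y) \<le> form_norm_wrt R H" if "y \<noteq> 0" for y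
    unfolding form_norm_wrt_def using that le
    by (intro cSUP_upper bdd_aboveI2[where M = c]) auto
  show "\<bar>y \<bullet> H y\<bar> \<le> form_norm_wrt R H * (y \<bullet> R y)"
    using up[of y] R[of y] linear_0[OF H] by (cases "y = 0") (auto simp: divide_le_eq)
  obtain y :: 'a where y: "y \<noteq> 0" using ne by blast
  have "0 \<le> \<bar>y \<bullet> H y\<bar> / (y \<bullet> R y)" using R[OF y] by simp
  also have "\<dots> \<le> form_norm_wrt R H" by (rule up[OF y])
  finally show "0 \<le> form_norm_wrt R H" .
qed

section \<open>The Hessian of the restriction to an affine graph\<close>

lemma inner_le_norm_orth_proj:
  fixes v :: "'a::euclidean_space"
  assumes T: "subspace T" and u: "u \<in> T"
  shows "\<bar>u \<bullet> v\<bar> \<le> norm (orth_proj T v) * norm u"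
proof -
  obtain w z where wz: "w \<in> T" "\<And>y. y \<in> T \<Longrightarrow> orthogonal z y" "v = w + z"
    using orthogonal_subspace_decomp_exists[of T v] T by (metis span_eq_iff)
  have "orth_proj T v = w"
    unfolding orth_proj_def
  proof (rule the_equality)
    show "w \<in> T \<and> (\<forall>u\<in>T. orthogonal (v - w) u)" using wz by simp
    fix w' assume w': "w' \<in> T \<and> (\<forall>u\<in>T. orthogonal (v - w') u)"
    have "w - w' \<in> T" using w' wz(1) T by (simp add: subspace_diff)
    then have "(v - w') \<bullet> (w - w') = 0" "z \<bullet> (w - w') = 0"
      using w' wz(2) by (auto simp: orthogonal_def)
    then have "(w - w') \<bullet> (w - w') = 0"
      by (simp add: wz(3) inner_add_left inner_diff_left)
    then show "w' = w" by simp
  qed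
  moreover have "u \<bullet> v = u \<bullet> w"
    using wz(2)[OF u] by (simp add: wz(3) inner_add_right orthogonal_def inner_commute)
  ultimately show ?thesis
    using Cauchy_Schwarz_ineq2[of u w] by (simp add: mult.commute)
qed

lemma graph_map_affine_derivative:
  fixes \<Psi> :: "'a::euclidean_space \<Rightarrow> 'b::euclidean_space"
  assumes "affine_map \<Psi>"
  obtains D where "\<And>x. (graph_map \<Psi> has_derivative D) (at x)" "\<And>h. norm h \<le> norm (D h)"
proof -
  obtain A b where A: "linear A" and \<Psi>: "\<Psi> = (\<lambda>x. A x + b)"
    using assms by (auto simp: affine_map_def)
  have "(A has_derivative A) (at x)" for x
    using A by (simp add: linear_linear bounded_linear_imp_has_derivative)
  then have "(graph_map \<Psi> has_derivative (\<lambda>h. (h, A h))) (at x)" for x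
    unfolding graph_map_def[abs_def] \<Psi>
    by (intro has_derivative_Pair has_derivative_ident has_derivative_add_const)
  moreover have "norm h \<le> norm (h, A h)" for h
    using norm_fst_le[of "h" "A h"] by simp
  ultimately show thesis using that by blast
qed

text \<open>The spectral gap estimate for tangent vectors of the graph, stated as a bound of the Hessian
  of \<open>f \<circ> \<Phi>\<close> relative to the pullback metric.\<close>

lemma hess_graph_form_bound:
  fixes f :: "'a::euclidean_space \<times> 'b::euclidean_space \<Rightarrow> real" and \<Psi> :: "'a \<Rightarrow> 'b"
  defines "\<Phi> \<equiv> graph_map \<Psi>"
  assumes f: "C2 f" and \<Psi>: "affine_map \<Psi>"
    and x: "\<And>v. v \<in> dominant_subspace (hess f (\<Phi> x)) \<Longrightarrow> norm v = 1 \<Longrightarrow>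
        norm (orth_proj (tangent_space \<Psi> (\<Phi> x)) v) \<le> c"
    and c: "0 \<le> c" "c < 1"
    and gap: "0 \<le> d" "d \<le> sing_max (hess f (\<Phi> x)) -
        sing_val (hess f (\<Phi> x)) (sing_mult (hess f (\<Phi> x)) (sing_max (hess f (\<Phi> x))) + 1)"
  shows "\<bar>y \<bullet> hess (f \<circ> \<Phi>) x y\<bar>
    \<le> (onorm (hess f (\<Phi> x)) - d * (1 - c\<^sup>2)) * (y \<bullet> pullback_op \<Phi> x y)"
proof -
  let ?H = "hess f (\<Phi> x)" and ?T = "tangent_space \<Psi> (\<Phi> x)"
  have df: "f differentiable (at z)" "grad f differentiable (at z)" for z
    using f unfolding C2_def by blast+
  obtain D where D: "\<And>x. (\<Phi> has_derivative D) (at x)"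
    using graph_map_affine_derivative[OF \<Psi>] unfolding \<Phi>_def by blast
  have linD: "linear D" using D by (rule has_derivative_linear)
  have D': "frechet_derivative \<Phi> (at z) = D" for z
    using frechet_derivative_at[OF D] by simp
  have T: "?T = range D"
    unfolding tangent_space_def using D' by (simp add: \<Phi>_def)
  have linH: "linear ?H" using has_derivative_hess[OF df(2)] by (rule has_derivative_linear)
  have "\<bar>D y \<bullet> ?H (D y)\<bar> \<le> (sing_max ?H - d * (1 - c\<^sup>2)) * (norm (D y))\<^sup>2"
  proof (rule symmetric_form_bound_by_spectral_gap[OF linH hess_symmetric[OF f] gap c])
    fix v assume v: "v \<in> dominant_subspace ?H"
    show "\<bar>D y \<bullet> v\<bar> \<le> c * norm (D y) * norm v"
    proof (cases "v = 0")
      case False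
      let ?v = "(1 / norm v) *\<^sub>R v"
      have "?v \<in> dominant_subspace ?H"
        using v by (simp add: dominant_subspace_def span_scale)
      then have "norm (orth_proj ?T ?v) \<le> c"
        using False by (intro x) auto
      moreover have "\<bar>D y \<bullet> ?v\<bar> \<le> norm (orth_proj ?T ?v) * norm (D y)"
        by (rule inner_le_norm_orth_proj)
          (auto simp: T intro: linear_subspace_image[OF linD subspace_UNIV])
      ultimately have "\<bar>D y \<bullet> ?v\<bar> \<le> c * norm (D y)"
        by (meson mult_right_mono norm_ge_zero order_trans)
      then show ?thesis
        using False by (simp add: abs_mult divide_le_eq)
    qed simp
  qed
  also have "\<dots> \<le> (onorm ?H - d * (1 - c\<^sup>2)) * (norm (D y))\<^sup>2"
    using sing_max_le_onorm[OF linH] by (intro mult_right_mono) auto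
  finally show ?thesis
    by (simp add: hess_comp_affine[OF df D] pullback_op_def D' adjoint_works[OF linD]
        power2_norm_eq_inner)
qed

section \<open>The smoothness constant of the restriction\<close>

theorem theorem1:
  fixes f :: "(real ^ 'n1) \<times> (real ^ 'n2) \<Rightarrow> real"
    and \<Psi> :: "real ^ 'n1 \<Rightarrow> real ^ 'n2"
    and \<Phi> :: "real ^ 'n1 \<Rightarrow> (real ^ 'n1) \<times> (real ^ 'n2)"
    and F :: "real ^ 'n1 \<Rightarrow> real"
    and N MF MF_loc :: "((real ^ 'n1) \<times> (real ^ 'n2)) set"
    and xbar :: "(real ^ 'n1) \<times> (real ^ 'n2)"
    and L \<beta>f \<mu>f \<beta>F \<epsilon> \<Delta>max :: real
    and p :: nat
  assumes f_C2: "C2 f"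
    and N: "compact N" "xbar \<in> minimisers f" "xbar \<in> interior N"
    and f_inf: "\<forall>x. 0 \<le> f x" "\<exists>x. f x = 0" "minimisers f \<noteq> {}"
    and pos: "0 < L" "0 < \<beta>f" "0 < \<mu>f"
    and f_Lip: "L-lipschitz_on N f"
    and \<beta>f: "\<beta>f = (SUP x\<in>N. onorm (hess f x))"
    and f_smooth: "\<beta>f-lipschitz_on N (grad f)"
    and f_PL: "\<forall>x\<in>N. f x \<le> 1 / (2 * \<mu>f) * (norm (grad f x))\<^sup>2"
    and \<Psi>: "affine_map \<Psi>"
    and \<Phi>: "\<Phi> = graph_map \<Psi>"
    and F: "F = f \<circ> \<Phi>"
    and MF: "MF = range \<Phi>"
    and MF_loc: "MF_loc = MF \<inter> N"
    and F_smooth: "\<exists>B>0. B-lipschitz_on (\<Phi> -` N) (grad F)"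
    and SF: "MF \<inter> minimisers f \<noteq> {}"
      "MF \<inter> minimisers f = \<Phi> ` {x1. \<forall>y1. F x1 \<le> F y1}"
    and \<beta>F: "\<beta>F = (SUP x1\<in>\<Phi> -` N. form_norm_wrt (pullback_op \<Phi> x1) (hess F x1))"
    and p: "1 \<le> p" "\<forall>x\<in>MF_loc. sing_mult (hess f x) (sing_max (hess f x)) = p"
    and \<epsilon>: "0 < \<epsilon>" "\<epsilon> \<le> 1"
    and transversal: "\<forall>x\<in>MF_loc. \<forall>v\<in>dominant_subspace (hess f x). norm v = 1 \<longrightarrow>
      norm (orth_proj (tangent_space \<Psi> x) v) \<le> 1 - \<epsilon>"
    (* the infimum is taken in the extended reals, so that a real value excludes MF_loc = {} *)
    and \<Delta>max: "ereal \<Delta>max =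
      (INF x\<in>MF_loc. ereal (sing_max (hess f x) - sing_val (hess f x) (p + 1)))"
    and gap: "0 < \<Delta>max"
  shows "riem_lipschitz_on \<beta>F (pullback_op \<Phi>) (\<Phi> -` N) (riem_grad (pullback_op \<Phi>) F)
    \<and> \<beta>F \<le> \<beta>f - \<Delta>max * (2 * \<epsilon> - \<epsilon>\<^sup>2)
    \<and> \<beta>f - \<Delta>max * (2 * \<epsilon> - \<epsilon>\<^sup>2) < \<beta>f"
proof -
  have df: "f differentiable (at z)" "grad f differentiable (at z)" for z
    using f_C2 unfolding C2_def by blast+
  have linH: "linear (hess f z)" for z
    using has_derivative_hess[OF df(2)] by (rule has_derivative_linear)
  obtain D where D: "\<And>x. (\<Phi> has_derivative D) (at x)" and D_ge: "\<And>h. norm h \<le> norm (D h)"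
    using graph_map_affine_derivative[OF \<Psi>] unfolding \<Phi> by blast
  have linD: "linear D" using D by (rule has_derivative_linear)
  define R where "R = (\<lambda>h. adjoint D (D h))"
  have R: "pullback_op \<Phi> x = R" for x
    using frechet_derivative_at[OF D, of x] by (simp add: pullback_op_def R_def o_def)
  have R_inner: "u \<bullet> R v = D u \<bullet> D v" for u v
    by (simp add: R_def adjoint_works[OF linD])
  have R_lin: "linear R"
    using linear_compose[OF linD adjoint_linear[OF linD]] by (simp add: R_def o_def)
  have R_sym: "R u \<bullet> v = u \<bullet> R v" for u v
    by (metis R_inner inner_commute)
  have R_pos: "0 < y \<bullet> R y" if "y \<noteq> 0" for y
    using that D_ge[of y] by (auto simp: R_inner)
  note F_deriv = has_derivative_comp_affine[OF df D, folded F]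
    has_derivative_grad_comp_affine[OF df D, folded F]
  have F_sym: "hess F x u \<bullet> v = u \<bullet> hess F x v" for x u v
    unfolding F hess_comp_affine[OF df D]
    by (simp add: adjoint_clauses[OF linD] hess_symmetric[OF f_C2])
  have F_lin: "linear (hess F x)" for x
    using F_deriv(2) by (rule has_derivative_linear)

  define c where "c = \<beta>f - \<Delta>max * (2 * \<epsilon> - \<epsilon>\<^sup>2)"
  have form_le: "\<bar>y \<bullet> hess F x y\<bar> \<le> c * (y \<bullet> R y)" if "x \<in> \<Phi> -` N" for x y
  proof -
    have x: "\<Phi> x \<in> MF_loc" "\<Phi> x \<in> N" using that by (auto simp: MF_loc MF)
    have "ereal \<Delta>max \<le> ereal (sing_max (hess f (\<Phi> x)) - sing_val (hess f (\<Phi> x)) (p + 1))"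
      unfolding \<Delta>max using x(1) by (rule INF_lower)
    then have "\<bar>y \<bullet> hess F x y\<bar> \<le>
        (onorm (hess f (\<Phi> x)) - \<Delta>max * (1 - (1 - \<epsilon>)\<^sup>2)) * (y \<bullet> pullback_op \<Phi> x y)"
      unfolding F using x(1) p(2) transversal gap \<epsilon> unfolding \<Phi>
      by (intro hess_graph_form_bound f_C2 \<Psi>) auto
    also have "1 - (1 - \<epsilon>)\<^sup>2 = 2 * \<epsilon> - \<epsilon>\<^sup>2"
      by (simp add: power2_eq_square algebra_simps)
    also have "(onorm (hess f (\<Phi> x)) - \<Delta>max * (2 * \<epsilon> - \<epsilon>\<^sup>2)) * (y \<bullet> pullback_op \<Phi> x y)
        \<le> c * (y \<bullet> R y)"
    proof -
      have "continuous_on N (\<lambda>x. hess f x v)" for v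
        using f_C2 unfolding C2_def by (meson continuous_on_subset subset_UNIV)
      then have "onorm (hess f (\<Phi> x)) \<le> \<beta>f"
        unfolding \<beta>f using x(2) N(1) linH by (intro cSUP_upper bdd_above_onorm_compact)
      then show ?thesis
        unfolding c_def R R_inner by (intro mult_right_mono) auto
    qed
    finally show ?thesis .
  qed

  \<comment> \<open>An empty set would make the infimum \<open>\<infinity>\<close>, which is not a real number.\<close>
  have ne: "\<Phi> -` N \<noteq> {}"
  proof
    assume "\<Phi> -` N = {}"
    then have "MF_loc = {}" by (auto simp: MF_loc MF)
    then show False using \<Delta>max by (simp add: top_ereal_def)
  qed
  have norm_F: "form_norm_wrt R (hess F x) \<le> c" "0 \<le> form_norm_wrt R (hess F x)"
      "\<bar>y \<bullet> hess F x y\<bar> \<le> form_norm_wrt R (hess F x) * (y \<bullet> R y)" if "x \<in> \<Phi> -` N" for x y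
    using form_norm_wrt_bounds[OF R_pos F_lin form_le[OF that]] by blast+
  have le_\<beta>F: "form_norm_wrt R (hess F x) \<le> \<beta>F" if "x \<in> \<Phi> -` N" for x
    unfolding \<beta>F R using that norm_F(1) by (intro cSUP_upper bdd_aboveI2)
  have "\<beta>F \<le> c"
    unfolding \<beta>F R using ne norm_F(1) by (rule cSUP_least)
  moreover have "0 \<le> \<beta>F"
    using ne norm_F(2) le_\<beta>F by (metis all_not_in_conv order_trans)
  moreover have "\<bar>y \<bullet> hess F x y\<bar> \<le> \<beta>F * (y \<bullet> R y)" if "x \<in> \<Phi> -` N" for x y
  proof -
    have "\<bar>y \<bullet> hess F x y\<bar> \<le> form_norm_wrt R (hess F x) * (y \<bullet> R y)"
      using that by (rule norm_F(3))
    also have "\<dots> \<le> \<beta>F * (y \<bullet> R y)"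
      using le_\<beta>F[OF that] by (intro mult_right_mono) (auto simp: R_inner)
    finally show ?thesis .
  qed
  moreover have "c < \<beta>f"
  proof -
    have "0 < \<epsilon> * (2 - \<epsilon>)" using \<epsilon> by simp
    also have "\<epsilon> * (2 - \<epsilon>) = 2 * \<epsilon> - \<epsilon>\<^sup>2"
      by (simp add: power2_eq_square algebra_simps)
    finally show ?thesis using gap by (simp add: c_def)
  qed
  ultimately show ?thesis
    using riem_lipschitz_on_riem_grad[of "pullback_op \<Phi>" R F \<beta>F "\<Phi> -` N",
        OF R R_lin R_sym R_pos F_deriv F_sym]
    by (simp add: c_def)
qed

end
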